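(* Let $\mathbf{e}_1,\mathbf{e}_2,\mathbf{e}_3$ be a left invariant frame on $\mathrm{SU}(2)$ with $[\mathbf{e}_2,\mathbf{e}_3]=\mathbf{e}_1$, $[\mathbf{e}_3,\mathbf{e}_1]=\mathbf{e}_2$, $[\mathbf{e}_1,\mathbf{e}_2]=\mathbf{e}_3$, with dual coframe $\omega^1,\omega^2,\omega^3$, and let $A,B,C>0$. The left invariant metric $\mathbf{g}=A\,\omega^{1}\otimes\omega^{1}+B\,\omega^{2}\otimes\omega^{2}+C\,\omega^{3}\otimes\omega^{3}$ is an algebraic soliton for the $\mathrm{XCF}$ on $\mathrm{SU}(2)$ if and only if $\mathbf{g}$ has constant sectional curvature (i.e. $A=B=C$).
   Context: Let $\mathfrak{h}$ denote the Lie algebra of $\mathrm{SU}(2)$. Cross curvature tensor: for a Riemannian metric $\mathbf{g}$ on a three-manifold with Ricci tensor $R_{ij}$ and scalar curvature $S$, put $P^{ij}=g^{ik}g^{jl}R_{kl}-\frac{S}{2}g^{ij}$. When $(P^{ij})$ is invertible with inverse $(V_{ij})$, the cross curvature tensor $\mathbf{H}[\mathbf{g}]$ has components $H_{ij}=\frac{\det P^{kl}}{\det g^{kl}}V_{ij}$. Equivalently, and also when $P$ is not invertible, in a local orthonormal frame $\mathbf{f}_1,\mathbf{f}_2,\mathbf{f}_3$ diagonalizing the Ricci tensor, $\mathbf{H}$ is diagonal with $H_{ll}=K_mK_n$ for $(l,m,n)$ any permutation of $(1,2,3)$, where $K_l$ is the sectional curvature of the plane spanned by $\mathbf{f}_m,\mathbf{f}_n$.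 The $\pm\mathrm{XCF}$ is $\frac{\partial\mathbf{g}}{\partial t}=\pm2\mathbf{H}[\mathbf{g}]$; "XCF" refers to either sign, and for algebraic solitons of $\pm\mathrm{XCF}$ one uses $\mathbf{T}=\pm\mathbf{H}$. The operator $\widehat{\mathbf{T}[\mathbf{g}]}:\mathfrak{h}\to\mathfrak{h}$ is defined by $\mathbf{g}(\widehat{\mathbf{T}[\mathbf{g}]}(X),Y)=\mathbf{T}[\mathbf{g}](X,Y)$. A left invariant metric $\mathbf{g}$ is an algebraic $\mathbf{T}$-soliton if there is $\kappa\in\mathbb{R}$ such that $\widehat{\mathbf{T}[\mathbf{g}]}-\kappa\,\mathrm{Id}$ is a derivation of $\mathfrak{h}$. *)

theory Defs
  imports "HOL-Analysis.Analysis"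
begin

text \<open>
  The geometry of SU(2) is set up on the group itself, embedded in the real vector space of
  complex 2 by 2 matrices. Vector fields are maps of that matrix space and metrics are families
  of bilinear forms indexed by it; only their values at points of \<open>SU2\<close>, respectively on tangent
  vectors, matter.
\<close>

type_synonym mat2 = "complex ^ 2 ^ 2"
type_synonym vfield = "mat2 \<Rightarrow> mat2"
type_synonym tensor2 = "mat2 \<Rightarrow> mat2 \<Rightarrow> mat2 \<Rightarrow> real"

definition adjoint_mat :: "mat2 \<Rightarrow> mat2" where
  "adjoint_mat U = (\<chi> i j. cnj (U $ j $ i))"

definition SU2 :: "mat2 set" where
  "SU2 = {U. U ** adjoint_mat U = mat 1 \<and> det U = 1}"

definition curve_at :: "(real \<Rightarrow> mat2) \<Rightarrow> mat2 \<Rightarrow> mat2 \<Rightarrow> bool" where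
  "curve_at \<gamma> p v \<longleftrightarrow>
     (\<forall>t. \<gamma> t \<in> SU2) \<and> \<gamma> 0 = p \<and> (\<gamma> has_vector_derivative v) (at 0)"

definition tangent_space :: "mat2 \<Rightarrow> mat2 set" where
  "tangent_space p = {v. \<exists>\<gamma>. curve_at \<gamma> p v}"

definition dir_deriv :: "(mat2 \<Rightarrow> 'b::real_normed_vector) \<Rightarrow> mat2 \<Rightarrow> mat2 \<Rightarrow> 'b" where
  "dir_deriv f p v =
     (THE d. \<forall>\<gamma>. curve_at \<gamma> p v \<longrightarrow> ((\<lambda>t. f (\<gamma> t)) has_vector_derivative d) (at 0))"

text \<open>
  For fields tangent to an embedded submanifold, the Lie bracket is the commutator of the ambient
  directional derivatives.
\<close>

definition lie_bracket :: "vfield \<Rightarrow> vfield \<Rightarrow> vfield" where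
  "lie_bracket V W = (\<lambda>p. dir_deriv W p (V p) - dir_deriv V p (W p))"

definition left_invariant :: "vfield \<Rightarrow> bool" where
  "left_invariant V \<longleftrightarrow>
     (\<forall>p\<in>SU2. V p \<in> tangent_space p) \<and> (\<forall>q\<in>SU2. \<forall>p\<in>SU2. V (q ** p) = q ** V p)"

text \<open>The left invariant vector field whose value at \<open>p\<close> is \<open>v\<close>.\<close>

definition left_ext :: "mat2 \<Rightarrow> mat2 \<Rightarrow> vfield" where
  "left_ext p v = (\<lambda>q. q ** (matrix_inv p ** v))"

definition basis_at :: "mat2 \<Rightarrow> (3 \<Rightarrow> mat2) \<Rightarrow> bool" where
  "basis_at p b \<longleftrightarrow> inj b \<and> independent (range b) \<and> span (range b) = tangent_space p"

definition left_invariant_frame :: "(3 \<Rightarrow> vfield) \<Rightarrow> bool" where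
  "left_invariant_frame e \<longleftrightarrow>
     (\<forall>i. left_invariant (e i)) \<and> (\<forall>p\<in>SU2. basis_at p (\<lambda>i. e i p))"

definition coframe :: "(3 \<Rightarrow> vfield) \<Rightarrow> 3 \<Rightarrow> mat2 \<Rightarrow> mat2 \<Rightarrow> real" where
  "coframe e i p v = representation (range (\<lambda>j. e j p)) v (e i p)"

definition diag_metric :: "(3 \<Rightarrow> vfield) \<Rightarrow> real \<Rightarrow> real \<Rightarrow> real \<Rightarrow> tensor2" where
  "diag_metric e A B C p v w =
     A * (coframe e 1 p v * coframe e 1 p w) +
     B * (coframe e 2 p v * coframe e 2 p w) +
     C * (coframe e 3 p v * coframe e 3 p w)"

text \<open>
  The Levi-Civita connection, by the Koszul formula. The right-hand side of that formula is
  tensorial in the third field, so it suffices to test it on one extension (the left invariant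
  one) of each tangent vector \<open>z\<close>.
\<close>

definition koszul :: "tensor2 \<Rightarrow> vfield \<Rightarrow> vfield \<Rightarrow> vfield \<Rightarrow> mat2 \<Rightarrow> real" where
  "koszul g X Y Z p =
     dir_deriv (\<lambda>q. g q (Y q) (Z q)) p (X p)
   + dir_deriv (\<lambda>q. g q (X q) (Z q)) p (Y p)
   - dir_deriv (\<lambda>q. g q (X q) (Y q)) p (Z p)
   + g p (lie_bracket X Y p) (Z p)
   - g p (lie_bracket X Z p) (Y p)
   - g p (lie_bracket Y Z p) (X p)"

definition levi_civita :: "tensor2 \<Rightarrow> vfield \<Rightarrow> vfield \<Rightarrow> vfield" where
  "levi_civita g X Y = (\<lambda>p. THE v. v \<in> tangent_space p \<and>
     (\<forall>z\<in>tangent_space p. 2 * g p v z = koszul g X Y (left_ext p z) p))"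

definition curvature_field :: "tensor2 \<Rightarrow> vfield \<Rightarrow> vfield \<Rightarrow> vfield \<Rightarrow> vfield" where
  "curvature_field g X Y Z = (\<lambda>p.
     levi_civita g X (levi_civita g Y Z) p
   - levi_civita g Y (levi_civita g X Z) p
   - levi_civita g (lie_bracket X Y) Z p)"

definition curvature :: "tensor2 \<Rightarrow> mat2 \<Rightarrow> mat2 \<Rightarrow> mat2 \<Rightarrow> mat2 \<Rightarrow> mat2" where
  "curvature g p x y z = curvature_field g (left_ext p x) (left_ext p y) (left_ext p z) p"

definition sectional :: "tensor2 \<Rightarrow> mat2 \<Rightarrow> mat2 \<Rightarrow> mat2 \<Rightarrow> real" where
  "sectional g p x y =
     g p (curvature g p x y y) x / (g p x x * g p y y - (g p x y)\<^sup>2)"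

definition constant_sectional_curvature :: "tensor2 \<Rightarrow> bool" where
  "constant_sectional_curvature g \<longleftrightarrow>
     (\<exists>k. \<forall>p\<in>SU2. \<forall>x\<in>tangent_space p. \<forall>y\<in>tangent_space p.
        x \<noteq> y \<and> independent {x, y} \<longrightarrow> sectional g p x y = k)"

text \<open>
  Components below are taken in a frame \<open>e\<close>; the tensors \<open>ricci\<close> and \<open>cross_curvature\<close> do not
  depend on its choice.
\<close>

definition ricci :: "(3 \<Rightarrow> vfield) \<Rightarrow> tensor2 \<Rightarrow> tensor2" where
  "ricci e g p x y = (\<Sum>i\<in>UNIV. coframe e i p (curvature g p (e i p) x y))"

definition components :: "(3 \<Rightarrow> vfield) \<Rightarrow> tensor2 \<Rightarrow> mat2 \<Rightarrow> real ^ 3 ^ 3" where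
  "components e T p = (\<chi> i j. T p (e i p) (e j p))"

definition inverse_metric :: "(3 \<Rightarrow> vfield) \<Rightarrow> tensor2 \<Rightarrow> mat2 \<Rightarrow> real ^ 3 ^ 3" where
  "inverse_metric e g p = matrix_inv (components e g p)"

definition scalar_curvature :: "(3 \<Rightarrow> vfield) \<Rightarrow> tensor2 \<Rightarrow> mat2 \<Rightarrow> real" where
  "scalar_curvature e g p =
     (\<Sum>i\<in>UNIV. \<Sum>j\<in>UNIV. inverse_metric e g p $ i $ j * components e (ricci e g) p $ i $ j)"

definition P_tensor :: "(3 \<Rightarrow> vfield) \<Rightarrow> tensor2 \<Rightarrow> mat2 \<Rightarrow> real ^ 3 ^ 3" where
  "P_tensor e g p = (\<chi> i j.
     (\<Sum>k\<in>UNIV. \<Sum>l\<in>UNIV. inverse_metric e g p $ i $ k * inverse_metric e g p $ j $ l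
        * components e (ricci e g) p $ k $ l)
     - scalar_curvature e g p / 2 * inverse_metric e g p $ i $ j)"

definition ricci_frame :: "(3 \<Rightarrow> vfield) \<Rightarrow> tensor2 \<Rightarrow> mat2 \<Rightarrow> (3 \<Rightarrow> mat2) \<Rightarrow> bool" where
  "ricci_frame e g p f \<longleftrightarrow> basis_at p f \<and>
     (\<forall>i j. g p (f i) (f j) = (if i = j then 1 else 0)) \<and>
     (\<forall>i j. i \<noteq> j \<longrightarrow> ricci e g p (f i) (f j) = 0)"

text \<open>
  The bilinear form that is diagonal in the orthonormal basis \<open>f\<close> with entries
  \<open>K2 * K3\<close>, \<open>K3 * K1\<close>, \<open>K1 * K2\<close>.
\<close>

definition cross_form :: "tensor2 \<Rightarrow> mat2 \<Rightarrow> (3 \<Rightarrow> mat2) \<Rightarrow> mat2 \<Rightarrow> mat2 \<Rightarrow> real" where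
  "cross_form g p f x y =
     (let K1 = sectional g p (f 2) (f 3);
          K2 = sectional g p (f 3) (f 1);
          K3 = sectional g p (f 1) (f 2)
      in K2 * K3 * (g p x (f 1) * g p y (f 1))
       + K3 * K1 * (g p x (f 2) * g p y (f 2))
       + K1 * K2 * (g p x (f 3) * g p y (f 3)))"

definition cross_curvature :: "(3 \<Rightarrow> vfield) \<Rightarrow> tensor2 \<Rightarrow> tensor2" where
  "cross_curvature e g p x y =
     (if invertible (P_tensor e g p)
      then \<Sum>i\<in>UNIV. \<Sum>j\<in>UNIV.
             det (P_tensor e g p) / det (inverse_metric e g p)
             * matrix_inv (P_tensor e g p) $ i $ j
             * (coframe e i p x * coframe e j p y)
      else THE h. \<forall>f. ricci_frame e g p f \<longrightarrow> h = cross_form g p f x y)"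

text \<open>The Lie algebra of SU(2): the tangent space at the identity, with the bracket of the
  corresponding left invariant fields.\<close>

definition su2 :: "mat2 set" where
  "su2 = tangent_space (mat 1)"

definition su2_bracket :: "mat2 \<Rightarrow> mat2 \<Rightarrow> mat2" where
  "su2_bracket x y = lie_bracket (left_ext (mat 1) x) (left_ext (mat 1) y) (mat 1)"

definition su2_derivation :: "(mat2 \<Rightarrow> mat2) \<Rightarrow> bool" where
  "su2_derivation D \<longleftrightarrow>
     (\<forall>x\<in>su2. D x \<in> su2) \<and>
     (\<forall>x\<in>su2. \<forall>y\<in>su2. D (x + y) = D x + D y) \<and>
     (\<forall>c. \<forall>x\<in>su2. D (c *\<^sub>R x) = c *\<^sub>R D x) \<and>
     (\<forall>x\<in>su2. \<forall>y\<in>su2. D (su2_bracket x y) = su2_bracket (D x) y + su2_bracket x (D y))"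

definition hat :: "tensor2 \<Rightarrow> tensor2 \<Rightarrow> mat2 \<Rightarrow> mat2" where
  "hat g T x = (THE v. v \<in> su2 \<and> (\<forall>y\<in>su2. g (mat 1) v y = T (mat 1) x y))"

definition algebraic_soliton :: "tensor2 \<Rightarrow> tensor2 \<Rightarrow> bool" where
  "algebraic_soliton g T \<longleftrightarrow> (\<exists>\<kappa>::real. su2_derivation (\<lambda>x. hat g T x - \<kappa> *\<^sub>R x))"

text \<open>The sign \<open>\<sigma>\<close> is \<open>1\<close> for +XCF and \<open>-1\<close> for -XCF.\<close>

definition xcf_algebraic_soliton :: "(3 \<Rightarrow> vfield) \<Rightarrow> real \<Rightarrow> tensor2 \<Rightarrow> bool" where
  "xcf_algebraic_soliton e \<sigma> g \<longleftrightarrow>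
     algebraic_soliton g (\<lambda>p x y. \<sigma> * cross_curvature e g p x y)"

end

theory Submission
  imports Defs
begin

text \<open>
  In a left invariant frame the Levi-Civita connection, the curvature and the Ricci tensor have
  constant coefficients, and for a diagonal metric the frame diagonalizes the Ricci tensor. Hence
  the operator of the cross curvature is \<open>diag (K\<^sub>2 K\<^sub>3, K\<^sub>3 K\<^sub>1, K\<^sub>1 K\<^sub>2)\<close>, with \<open>K\<^sub>i\<close> the
  sectional curvatures of the coordinate planes. A diagonal derivation \<open>diag (d\<^sub>1, d\<^sub>2, d\<^sub>3)\<close>
  satisfies \<open>d\<^sub>1 = d\<^sub>2 + d\<^sub>3\<close> and its cyclic permutations, so it vanishes, and a soliton has
  \<open>K\<^sub>2 K\<^sub>3 = K\<^sub>3 K\<^sub>1 = K\<^sub>1 K\<^sub>2\<close>. Two of the \<open>K\<^sub>i\<close> cannot vanish together, so all of them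
  agree, which forces \<open>A = B = C\<close>.
\<close>

subsection \<open>Diagonal metrics on the Lie algebra with bracket the cross product\<close>

definition diag_ip :: "real \<Rightarrow> real \<Rightarrow> real \<Rightarrow> real^3 \<Rightarrow> real^3 \<Rightarrow> real" where
  "diag_ip A B C x y = A * (x$1 * y$1) + B * (x$2 * y$2) + C * (x$3 * y$3)"

text \<open>The Levi-Civita connection in coordinates of a left invariant frame: the derivative
  terms of the Koszul formula vanish on left invariant fields, and the bracket terms, with bracket
  \<open>cross3\<close>, are solved for these coefficients.\<close>

definition lc_conn :: "real \<Rightarrow> real \<Rightarrow> real \<Rightarrow> real^3 \<Rightarrow> real^3 \<Rightarrow> real^3" where
  "lc_conn A B C x y = vector
     [((A + C - B) * (x$2 * y$3) - (A + B - C) * (x$3 * y$2)) / (2 * A),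
      ((A + B - C) * (x$3 * y$1) - (B + C - A) * (x$1 * y$3)) / (2 * B),
      ((B + C - A) * (x$1 * y$2) - (A + C - B) * (x$2 * y$1)) / (2 * C)]"

definition lc_curv :: "real \<Rightarrow> real \<Rightarrow> real \<Rightarrow> real^3 \<Rightarrow> real^3 \<Rightarrow> real^3 \<Rightarrow> real^3" where
  "lc_curv A B C x y z =
     lc_conn A B C x (lc_conn A B C y z) - lc_conn A B C y (lc_conn A B C x z)
     - lc_conn A B C (cross3 x y) z"

text \<open>The sectional curvature of the plane of \<open>e 2, e 3\<close>; cyclic permutations of the arguments
  give the other two coordinate planes.\<close>

definition plane_curv :: "real \<Rightarrow> real \<Rightarrow> real \<Rightarrow> real" where
  "plane_curv A B C =
     ((B + C - A) * (A + C - B) + (B + C - A) * (A + B - C) - (A + C - B) * (A + B - C))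
     / (4 * A * B * C)"

lemma diag_ip_lc_conn:
  assumes "A > 0" "B > 0" "C > 0"
  shows "2 * diag_ip A B C (lc_conn A B C x y) z =
    diag_ip A B C (cross3 x y) z - diag_ip A B C (cross3 x z) y - diag_ip A B C (cross3 y z) x"
  using assms by (simp add: diag_ip_def lc_conn_def cross_components) (simp add: algebra_simps)

text \<open>Nondegeneracy, tested on the coordinate vectors. It supplies uniqueness in the
  descriptions behind \<open>levi_civita\<close> and \<open>hat\<close>.\<close>

lemma diag_ip_eqD:
  assumes "A > 0" "B > 0" "C > 0" "\<And>z. diag_ip A B C x z = diag_ip A B C y z"
  shows "x = y"
  using assms(1-3) assms(4)[of "axis 1 1"] assms(4)[of "axis 2 1"] assms(4)[of "axis 3 1"]
  by (simp add: diag_ip_def axis_def vec_eq_iff forall_3)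

text \<open>The curvature sees \<open>x\<close> and \<open>y\<close> only through
  \<open>cross3 x y\<close>, and the curvature operator is diagonal in the coordinate planes.
  Clearing denominators leaves polynomial identities.\<close>

lemma lc_curv_eq:
  assumes "A > 0" "B > 0" "C > 0"
  shows "lc_curv A B C x y z = vector
    [B * plane_curv C A B * (cross3 x y $ 3 * z$2) - C * plane_curv B C A * (cross3 x y $ 2 * z$3),
     C * plane_curv A B C * (cross3 x y $ 1 * z$3) - A * plane_curv C A B * (cross3 x y $ 3 * z$1),
     A * plane_curv B C A * (cross3 x y $ 2 * z$1) - B * plane_curv A B C * (cross3 x y $ 1 * z$2)]"
proof -
  have nz: "A \<noteq> 0" "B \<noteq> 0" "C \<noteq> 0" using assms by auto
  have "lc_curv A B C x y z $ 1 =
    B * plane_curv C A B * (cross3 x y $ 3 * z$2) - C * plane_curv B C A * (cross3 x y $ 2 * z$3)"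
    using nz by (simp add: lc_curv_def lc_conn_def plane_curv_def cross_components divide_simps)
       (simp add: algebra_simps)
  moreover have "lc_curv A B C x y z $ 2 =
    C * plane_curv A B C * (cross3 x y $ 1 * z$3) - A * plane_curv C A B * (cross3 x y $ 3 * z$1)"
    using nz by (simp add: lc_curv_def lc_conn_def plane_curv_def cross_components divide_simps)
       (simp add: algebra_simps)
  moreover have "lc_curv A B C x y z $ 3 =
    A * plane_curv B C A * (cross3 x y $ 2 * z$1) - B * plane_curv A B C * (cross3 x y $ 1 * z$2)"
    using nz by (simp add: lc_curv_def lc_conn_def plane_curv_def cross_components divide_simps)
       (simp add: algebra_simps)
  ultimately show ?thesis by (simp add: vec_eq_iff forall_3)
qed

lemma diag_ip_lc_curv:
  assumes "A > 0" "B > 0" "C > 0"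
  shows "diag_ip A B C (lc_curv A B C x y y) x =
     B * C * plane_curv A B C * (cross3 x y $ 1)\<^sup>2 + C * A * plane_curv B C A * (cross3 x y $ 2)\<^sup>2
     + A * B * plane_curv C A B * (cross3 x y $ 3)\<^sup>2"
  unfolding lc_curv_eq[OF assms]
  by (simp add: diag_ip_def cross_components power2_eq_square algebra_simps)

lemma diag_ip_gram:
  "diag_ip A B C x x * diag_ip A B C y y - (diag_ip A B C x y)\<^sup>2 =
     B * C * (cross3 x y $ 1)\<^sup>2 + C * A * (cross3 x y $ 2)\<^sup>2 + A * B * (cross3 x y $ 3)\<^sup>2"
  by (simp add: diag_ip_def cross_components power2_eq_square algebra_simps)

lemma ricci_coord:
  assumes "A > 0" "B > 0" "C > 0"
  shows "(\<Sum>i\<in>UNIV. lc_curv A B C (axis i 1) x y $ i) =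
    A * (plane_curv B C A + plane_curv C A B) * (x$1 * y$1)
    + B * (plane_curv A B C + plane_curv C A B) * (x$2 * y$2)
    + C * (plane_curv A B C + plane_curv B C A) * (x$3 * y$3)"
  unfolding lc_curv_eq[OF assms]
  by (simp add: sum_3 cross_components axis_def algebra_simps)

text \<open>Equal pairwise products mean that all three curvatures agree or that two of them vanish;
  the second alternative contradicts positivity.\<close>

lemma plane_curv_products_eqD:
  assumes "A > 0" "B > 0" "C > 0"
    and "plane_curv B C A * plane_curv C A B = plane_curv C A B * plane_curv A B C"
    and "plane_curv C A B * plane_curv A B C = plane_curv A B C * plane_curv B C A"
  shows "A = B \<and> B = C"
proof -
  \<comment> \<open>The pair sums \<open>a + b\<close>, \<open>b + c\<close>, \<open>a + c\<close>
    are \<open>2 * C\<close>, \<open>2 * A\<close>, \<open>2 * B\<close>, so no two of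
    \<open>a\<close>, \<open>b\<close>, \<open>c\<close> vanish.\<close>
  define a b c where "a = B + C - A" and "b = A + C - B" and "c = A + B - C"
  have pos: "a + b > 0" "b + c > 0" "a + c > 0" using assms by (auto simp: a_def b_def c_def)
  define D where "D = 4 * A * B * C"
  have D: "D \<noteq> 0" using assms by (simp add: D_def)
  define k l m where "k = a * b + a * c - b * c" and "l = b * c + b * a - c * a"
    and "m = c * a + c * b - a * b"
  have k: "plane_curv A B C = k / D" "plane_curv B C A = l / D" "plane_curv C A B = m / D"
    by (simp_all add: plane_curv_def a_def b_def c_def D_def k_def l_def m_def algebra_simps)
  have "l * m = m * k" "m * k = k * l" using assms(4,5) D unfolding k by (auto simp: divide_simps)
  then consider "k = l" "l = m" | "k = 0" "l = 0" | "l = 0" "m = 0" | "k = 0" "m = 0" by (auto)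
  then have "a = b \<and> b = c"
  proof cases
    case 1
    then have "a * b = b * c" "b * c = c * a" by (auto simp: k_def l_def m_def algebra_simps)
    then show ?thesis using pos by (auto simp: mult.commute)
  next
    case 2
    \<comment> \<open>The sum of two numerators isolates one product. Its vanishing kills one
      factor, and the other equation then kills a second of \<open>a\<close>, \<open>b\<close>,
      \<open>c\<close>.\<close>
    moreover have "2 * (a * b) = k + l" by (simp add: k_def l_def)
    ultimately have "a * b = 0" "a * c = b * c" by (auto simp: k_def)
    then show ?thesis using pos by auto
  next
    case 3
    moreover have "2 * (b * c) = l + m" by (simp add: l_def m_def)
    ultimately have "b * c = 0" "b * a = c * a" by (auto simp: l_def)
    then show ?thesis using pos by auto
  next
    case 4
    moreover have "2 * (a * c) = k + m" by (simp add: k_def m_def)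
    ultimately have "a * c = 0" "a * b = c * b" by (auto simp: k_def)
    then show ?thesis using pos by auto
  qed
  then show ?thesis by (auto simp: a_def b_def c_def)
qed

section \<open>Orthonormal bases of \<open>real^3\<close> and the cofactor form\<close>

lemma orthonormal_expansion:
  fixes u :: "3 \<Rightarrow> real^3"
  assumes "\<And>i j. u i \<bullet> u j = (if i = j then 1 else 0)"
  shows "(\<Sum>l\<in>UNIV. (x \<bullet> u l) *\<^sub>R u l) = x"
proof -
  \<comment> \<open>The matrix with rows \<open>u i\<close> is orthogonal; its transpose, as a left
    inverse, yields the expansion of \<open>x\<close>.\<close>
  have "orthogonal_matrix (\<chi> i. u i)"
    unfolding orthogonal_matrix_orthonormal_rows
    using assms by (auto simp: row_def orthogonal_def norm_eq_1)
  then have *: "transpose (\<chi> i. u i) ** (\<chi> i. u i) = mat 1" by (simp add: orthogonal_matrix_def)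
  have "(\<Sum>l\<in>UNIV. (x \<bullet> u l) *\<^sub>R u l) = (transpose (\<chi> i. u i) ** (\<chi> i. u i)) *v x"
    unfolding matrix_vector_mul_assoc[symmetric]
    by (simp add: vec_eq_iff matrix_vector_mult_def transpose_def inner_vec_def sum_3 forall_3
      algebra_simps)
  then show ?thesis unfolding * by simp
qed

lemma orthonormal_cross:
  fixes u :: "3 \<Rightarrow> real^3"
  assumes on: "\<And>i j. u i \<bullet> u j = (if i = j then 1 else 0)"
  obtains t where "t\<^sup>2 = 1" "cross3 (u 2) (u 3) = t *\<^sub>R u 1"
    "cross3 (u 3) (u 1) = t *\<^sub>R u 2" "cross3 (u 1) (u 2) = t *\<^sub>R u 3"
proof
  \<comment> \<open>The triple product is the orientation sign of the basis. It is cyclically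
    invariant, so one \<open>t\<close> serves all three equations.\<close>
  define t where "t = cross3 (u 1) (u 2) \<bullet> u 3"
  have t: "cross3 (u 2) (u 3) \<bullet> u 1 = t" "cross3 (u 3) (u 1) \<bullet> u 2 = t"
    unfolding t_def by (metis cross_triple)+
  show c: "cross3 (u 2) (u 3) = t *\<^sub>R u 1" "cross3 (u 3) (u 1) = t *\<^sub>R u 2"
    "cross3 (u 1) (u 2) = t *\<^sub>R u 3"
    using orthonormal_expansion[OF on, of "cross3 (u 2) (u 3)"]
      orthonormal_expansion[OF on, of "cross3 (u 3) (u 1)"]
      orthonormal_expansion[OF on, of "cross3 (u 1) (u 2)"] t t_def
    by (simp_all add: sum_3 dot_cross_self)
  have "cross3 (u 2) (u 3) \<bullet> cross3 (u 2) (u 3) = 1"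
    by (simp add: dot_cross on)
  then show "t\<^sup>2 = 1" by (simp add: c on power2_eq_square)
qed

text \<open>The diagonal operator with entries \<open>k\<^sub>m k\<^sub>n\<close> is the adjugate of \<open>D = diag k\<close>, and
  \<open>D x \<times> D y = adj D (x \<times> y)\<close>; hence an orthonormal eigenbasis of \<open>D\<close> with eigenvalues \<open>K\<close> is
  one of the adjugate with eigenvalues \<open>K\<^sub>m K\<^sub>n\<close>.\<close>

lemma cofactor_form_orthonormal_frame:
  fixes u :: "3 \<Rightarrow> real^3" and k :: "real^3"
  assumes on: "\<And>i j. u i \<bullet> u j = (if i = j then 1 else 0)"
    and off: "\<And>i j. i \<noteq> j \<Longrightarrow> (\<Sum>n\<in>UNIV. k$n * (u i $ n * u j $ n)) = 0"
    and K: "\<And>i. K i = (\<Sum>n\<in>UNIV. k$n * (u i $ n)\<^sup>2)"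
  shows "K 2 * K 3 * ((x \<bullet> u 1) * (y \<bullet> u 1)) + K 3 * K 1 * ((x \<bullet> u 2) * (y \<bullet> u 2))
    + K 1 * K 2 * ((x \<bullet> u 3) * (y \<bullet> u 3))
   = k$2 * k$3 * (x$1 * y$1) + k$3 * k$1 * (x$2 * y$2) + k$1 * k$2 * (x$3 * y$3)"
proof -
  define D where "D x = (\<chi> n. k$n * x$n)" for x :: "real^3"
  define M where "M x = (vector [k$2 * k$3 * x$1, k$3 * k$1 * x$2, k$1 * k$2 * x$3] :: real^3)"
    for x :: "real^3"
  have DM: "cross3 (D x) (D y) = M (cross3 x y)" for x y
    by (simp add: D_def M_def vec_eq_iff forall_3 cross_components algebra_simps)
  have Du: "D (u i) \<bullet> u j = (if i = j then K i else 0)" for i j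
    using off[of i j] by (simp add: D_def K inner_vec_def power2_eq_square mult.assoc)
  have eig: "D (u i) = K i *\<^sub>R u i" for i
    using orthonormal_expansion[OF on, of "D (u i)"] unfolding Du
    by (simp add: if_distrib[of "\<lambda>c. c *\<^sub>R _"] cong: if_cong)
  obtain t where t: "t\<^sup>2 = 1" and c: "cross3 (u 2) (u 3) = t *\<^sub>R u 1"
    "cross3 (u 3) (u 1) = t *\<^sub>R u 2" "cross3 (u 1) (u 2) = t *\<^sub>R u 3"
    using orthonormal_cross[OF on] by metis
  have "t \<noteq> 0" using t by auto
  have Ms: "M (c *\<^sub>R x) = c *\<^sub>R M x" for c x by (simp add: M_def vec_eq_iff forall_3)
  \<comment> \<open>The orientation sign occurs once on each side of \<open>DM\<close> for two basis
    vectors, so it cancels and either orientation of \<open>u\<close> is covered.\<close>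
  have cancel: "a *\<^sub>R b *\<^sub>R t *\<^sub>R v = t *\<^sub>R w \<longleftrightarrow> (a * b) *\<^sub>R v = w" for a b and v w :: "real^3"
  proof -
    have "a *\<^sub>R b *\<^sub>R t *\<^sub>R v = t *\<^sub>R ((a * b) *\<^sub>R v)" by (simp add: mult_ac)
    then show ?thesis using \<open>t \<noteq> 0\<close> by (metis scaleR_cancel_left)
  qed
  have M: "(K 2 * K 3) *\<^sub>R u 1 = M (u 1)" "(K 3 * K 1) *\<^sub>R u 2 = M (u 2)"
    "(K 1 * K 2) *\<^sub>R u 3 = M (u 3)"
    using DM[of "u 2" "u 3"] DM[of "u 3" "u 1"] DM[of "u 1" "u 2"]
    unfolding eig cross_mult_left cross_mult_right c Ms cancel by (simp_all add: mult.commute)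
  have "M x \<bullet> y = M (\<Sum>l\<in>UNIV. (x \<bullet> u l) *\<^sub>R u l) \<bullet> y" unfolding orthonormal_expansion[OF on] ..
  also have "\<dots> = ((x \<bullet> u 1) *\<^sub>R M (u 1) + (x \<bullet> u 2) *\<^sub>R M (u 2) + (x \<bullet> u 3) *\<^sub>R M (u 3)) \<bullet> y"
    by (simp add: M_def inner_vec_def sum_3 algebra_simps)
  also have "\<dots> = K 2 * K 3 * ((x \<bullet> u 1) * (y \<bullet> u 1)) + K 3 * K 1 * ((x \<bullet> u 2) * (y \<bullet> u 2))
    + K 1 * K 2 * ((x \<bullet> u 3) * (y \<bullet> u 3))"
    unfolding M[symmetric] by (simp add: inner_add_left inner_commute algebra_simps)
  finally show ?thesis by (simp add: M_def inner_vec_def sum_3 mult.assoc)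
qed

section \<open>Inverse and determinant of diagonal matrices\<close>

lemma matrix_inv_eqI:
  fixes M :: "'a::field^'n^'n"
  assumes "M ** N = mat 1"
  shows "matrix_inv M = N"
proof -
  have "N ** M = mat 1" using assms matrix_left_right_inverse by blast
  \<comment> \<open>\<open>matrix_inv\<close> chooses a two-sided inverse; \<open>N\<close>
    witnesses that one exists, and associativity then identifies the choice with
    \<open>N\<close>.\<close>
  then have "M ** matrix_inv M = mat 1"
    unfolding matrix_inv_def using assms by (metis (mono_tags, lifting) someI)
  then have "N ** (M ** matrix_inv M) = N" by simp
  then show ?thesis by (simp add: matrix_mul_assoc \<open>N ** M = mat 1\<close>)
qed

lemma matrix_inv_diag:
  assumes "a \<noteq> 0" "b \<noteq> 0" "c \<noteq> (0::real)"
  shows "matrix_inv ((\<chi> i j. if i = j then vector [a,b,c] $ i else 0)::real^3^3) =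
    (\<chi> i j. if i = j then vector [1/a,1/b,1/c] $ i else 0)"
  using assms by (intro matrix_inv_eqI)
    (simp add: vec_eq_iff forall_3 matrix_matrix_mult_def sum_3 mat_def)

lemma det_diag:
  "det ((\<chi> i j. if i = j then vector [a,b,c] $ i else 0)::real^3^3) = a * b * c"
  by (simp add: det_3)

subsection \<open>Left invariant fields\<close>

lemma matrix_add_rdistrib: "(M + N) ** P = M ** P + N ** P"
  for M :: "'a::semiring_1^'n^'m"
  by (simp add: vec_eq_iff matrix_matrix_mult_def distrib_right sum.distrib)

lemma matrix_mul_scaleR_left: "(c *\<^sub>R M) ** N = c *\<^sub>R (M ** N)"
  for M :: "'a::real_algebra_1^'n^'m"
  by (simp add: vec_eq_iff matrix_matrix_mult_def scaleR_sum_right)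

lemma matrix_mul_scaleR_right: "M ** (c *\<^sub>R N) = c *\<^sub>R (M ** N)"
  for M :: "'a::real_algebra_1^'n^'m"
  by (simp add: vec_eq_iff matrix_matrix_mult_def scaleR_sum_right)

lemma bounded_linear_matrix_mul_left: "bounded_linear (\<lambda>M. M ** N)"
  for N :: "'a::{euclidean_space,real_algebra_1}^'n^'m"
  unfolding linear_conv_bounded_linear[symmetric]
  by (intro linearI) (simp_all add: matrix_add_rdistrib matrix_mul_scaleR_left)

lemma mat_1_in_SU2: "mat 1 \<in> SU2"
proof -
  have "adjoint_mat (mat 1) = mat 1"
    by (auto simp: adjoint_mat_def mat_def vec_eq_iff)
  then show ?thesis by (simp add: SU2_def)
qed

lemma SU2_matrix_inv:
  assumes "p \<in> SU2" shows "matrix_inv p ** p = mat 1"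
proof -
  have "p ** adjoint_mat p = mat 1" using assms by (simp add: SU2_def)
  then show ?thesis
    using matrix_left_right_inverse[of p "adjoint_mat p"] by (simp add: matrix_inv_eqI)
qed

text \<open>Tangency supplies at least one curve, and uniqueness of the derivative along it makes
  the definite description well defined.\<close>

lemma dir_deriv_eqI:
  assumes "v \<in> tangent_space p"
    and "\<And>\<gamma>. curve_at \<gamma> p v \<Longrightarrow> ((\<lambda>t. f (\<gamma> t)) has_vector_derivative d) (at 0)"
  shows "dir_deriv f p v = d"
  unfolding dir_deriv_def
proof (rule the_equality)
  fix d' assume *: "\<forall>\<gamma>. curve_at \<gamma> p v \<longrightarrow> ((\<lambda>t. f (\<gamma> t)) has_vector_derivative d') (at 0)"
  obtain \<gamma> where "curve_at \<gamma> p v" using assms(1) by (auto simp: tangent_space_def)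
  with * assms(2) show "d' = d" by (blast intro: vector_derivative_unique_at)
qed (use assms(2) in blast)

text \<open>Admissible curves stay in \<open>SU2\<close>, so constancy on the group suffices. This
  removes the derivative terms from the Koszul formula.\<close>

lemma dir_deriv_const:
  assumes "v \<in> tangent_space p" and "\<And>q. q \<in> SU2 \<Longrightarrow> f q = c"
  shows "dir_deriv f p v = 0"
proof (rule dir_deriv_eqI[OF assms(1)])
  fix \<gamma> assume "curve_at \<gamma> p v"
  then have "(\<lambda>t. f (\<gamma> t)) = (\<lambda>t. c)" using assms(2) by (auto simp: curve_at_def)
  then show "((\<lambda>t. f (\<gamma> t)) has_vector_derivative 0) (at 0)" by simp
qed

text \<open>Left invariant fields have this form, with \<open>N\<close> the value at the identity;
  right multiplication is linear, hence its own derivative.\<close>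

lemma dir_deriv_right_mult:
  fixes f :: vfield
  assumes "v \<in> tangent_space p" and "\<And>q. q \<in> SU2 \<Longrightarrow> f q = q ** N"
  shows "dir_deriv f p v = v ** N"
proof (rule dir_deriv_eqI[OF assms(1)])
  fix \<gamma> assume c: "curve_at \<gamma> p v"
  then have "(\<lambda>t. f (\<gamma> t)) = (\<lambda>t. \<gamma> t ** N)" using assms(2) by (auto simp: curve_at_def)
  moreover have "((\<lambda>t. \<gamma> t ** N) has_vector_derivative v ** N) (at 0)"
    using c bounded_linear.has_vector_derivative[OF bounded_linear_matrix_mul_left]
    unfolding curve_at_def by blast
  ultimately show "((\<lambda>t. f (\<gamma> t)) has_vector_derivative v ** N) (at 0)" by simp
qed

section \<open>Left invariant frames and their coordinates\<close>

locale su2_frame =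
  fixes e :: "3 \<Rightarrow> vfield"
  assumes frame: "left_invariant_frame e"
    and br23: "\<forall>p\<in>SU2. lie_bracket (e 2) (e 3) p = e 1 p"
    and br31: "\<forall>p\<in>SU2. lie_bracket (e 3) (e 1) p = e 2 p"
    and br12: "\<forall>p\<in>SU2. lie_bracket (e 1) (e 2) p = e 3 p"
begin

definition frame_comb :: "real^3 \<Rightarrow> vfield" where
  "frame_comb a p = (\<Sum>i\<in>UNIV. a$i *\<^sub>R e i p)"

text \<open>Agreement is asked on the group only, since the values of a field at other matrices are
  arbitrary.\<close>

definition represents :: "vfield \<Rightarrow> real^3 \<Rightarrow> bool" where
  "represents X a \<longleftrightarrow> (\<forall>q\<in>SU2. X q = frame_comb a q)"

lemma frame_comb_add: "frame_comb (a + b) p = frame_comb a p + frame_comb b p"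
  and frame_comb_diff: "frame_comb (a - b) p = frame_comb a p - frame_comb b p"
  and frame_comb_scaleR: "frame_comb (c *\<^sub>R a) p = c *\<^sub>R frame_comb a p"
  by (simp_all add: frame_comb_def sum_3 algebra_simps)

lemma frame_comb_zero: "frame_comb 0 p = 0"
  by (simp add: frame_comb_def)

lemma frame_comb_axis: "frame_comb (axis i 1) p = e i p"
  by (simp add: frame_comb_def axis_def if_distrib[of "\<lambda>c. c *\<^sub>R _"] cong: if_cong)

lemma basis: "p \<in> SU2 \<Longrightarrow> basis_at p (\<lambda>i. e i p)"
  using frame by (auto simp: left_invariant_frame_def)

lemma tangent_space_eq:
  assumes "p \<in> SU2" shows "tangent_space p = range (\<lambda>a. frame_comb a p)"
proof -
  have "inj (\<lambda>i. e i p)" and s: "tangent_space p = span (range (\<lambda>i. e i p))"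
    using basis[OF assms] by (auto simp: basis_at_def)
  show ?thesis
  proof
    have "frame_comb a p \<in> tangent_space p" for a
      unfolding s frame_comb_def by (rule span_sum, rule span_scale, rule span_base, rule rangeI)
    then show "range (\<lambda>a. frame_comb a p) \<subseteq> tangent_space p" by blast
    have "span (range (\<lambda>i. e i p)) \<subseteq> range (\<lambda>a. frame_comb a p)"
    proof (rule span_minimal)
      show "range (\<lambda>i. e i p) \<subseteq> range (\<lambda>a. frame_comb a p)"
      proof (rule image_subsetI)
        fix i show "e i p \<in> range (\<lambda>a. frame_comb a p)"
          using rangeI[of "\<lambda>a. frame_comb a p" "axis i 1"] by (simp only: frame_comb_axis)
      qed
      show "subspace (range (\<lambda>a. frame_comb a p))"
        unfolding subspace_def
      proof (intro conjI)
        show "0 \<in> range (\<lambda>a. frame_comb a p)"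
          using rangeI[of "\<lambda>a. frame_comb a p" 0] by (simp only: frame_comb_zero)
      qed (auto simp: frame_comb_add[symmetric] frame_comb_scaleR[symmetric])
    qed
    then show "tangent_space p \<subseteq> range (\<lambda>a. frame_comb a p)" using s by simp
  qed
qed

lemma frame_comb_tangent: "p \<in> SU2 \<Longrightarrow> frame_comb a p \<in> tangent_space p"
  by (simp add: tangent_space_eq)

lemma coframe_frame_comb:
  assumes "p \<in> SU2" shows "coframe e i p (frame_comb a p) = a $ i"
proof -
  have inj: "inj (\<lambda>i. e i p)" and ind: "independent (range (\<lambda>i. e i p))"
    using basis[OF assms] by (auto simp: basis_at_def)
  have *: "e j p \<in> span (range (\<lambda>i. e i p))" for j by (simp add: span_base)
  have **: "representation (range (\<lambda>i. e i p)) (e j p) (e i p) = (if j = i then 1 else 0)" for j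
    using representation_basis[OF ind, of "e j p"] inj by (auto dest: injD)
  show ?thesis
    unfolding coframe_def frame_comb_def
    by (simp add: representation_sum[OF ind] representation_scale[OF ind] span_scale * **
        if_distrib[of "\<lambda>c. _ * c"] cong: if_cong)
qed

lemma frame_comb_eq_iff: "p \<in> SU2 \<Longrightarrow> frame_comb a p = frame_comb b p \<longleftrightarrow> a = b"
  by (metis coframe_frame_comb vec_eq_iff)

lemma diag_metric_frame_comb:
  "p \<in> SU2 \<Longrightarrow> diag_metric e A B C p (frame_comb a p) (frame_comb b p) = diag_ip A B C a b"
  by (simp add: diag_metric_def diag_ip_def coframe_frame_comb)

lemma frame_comb_left:
  assumes "p \<in> SU2" shows "frame_comb a p = p ** frame_comb a (mat 1)"
proof -
  have "e i (p ** mat 1) = p ** e i (mat 1)" for i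
    using frame assms mat_1_in_SU2 unfolding left_invariant_frame_def left_invariant_def by blast
  then show ?thesis
    by (simp add: frame_comb_def sum_3 matrix_add_ldistrib matrix_mul_scaleR_right)
qed

lemma represents_e: "represents (e i) (axis i 1)"
  by (simp_all add: represents_def frame_comb_axis)

text \<open>\<open>matrix_inv p\<close> carries the frame at \<open>p\<close> back to the frame at
  the identity, so the extension keeps the coordinates.\<close>

lemma represents_left_ext:
  assumes "p \<in> SU2" shows "represents (left_ext p (frame_comb a p)) a"
proof -
  have "matrix_inv p ** frame_comb a p = frame_comb a (mat 1)"
    using SU2_matrix_inv[OF assms] by (simp add: frame_comb_left[OF assms] matrix_mul_assoc)
  then show ?thesis by (simp add: represents_def left_ext_def frame_comb_left)
qed

lemma dir_deriv_represents:
  assumes "represents X a" "p \<in> SU2"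
  shows "dir_deriv X p (frame_comb b p) = frame_comb b p ** frame_comb a (mat 1)"
  using assms frame_comb_left
  by (intro dir_deriv_right_mult frame_comb_tangent) (auto simp: represents_def)

lemma lie_bracket_represents_commutator:
  assumes "represents X a" "represents Y b" "p \<in> SU2"
  shows "lie_bracket X Y p =
    frame_comb a p ** frame_comb b (mat 1) - frame_comb b p ** frame_comb a (mat 1)"
  using assms dir_deriv_represents[of X a p b] dir_deriv_represents[of Y b p a]
  by (simp add: lie_bracket_def represents_def)

lemma lie_bracket_represents:
  assumes "represents X a" "represents Y b"
  shows "represents (lie_bracket X Y) (cross3 a b)"
  unfolding represents_def
proof
  fix p assume p: "p \<in> SU2"
  have c: "e i p ** e j (mat 1) - e j p ** e i (mat 1) = lie_bracket (e i) (e j) p" for i j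
    using lie_bracket_represents_commutator[OF represents_e represents_e p, of i j]
    by (simp add: frame_comb_axis)
  \<comment> \<open>The frame brackets become rules that reorder products of frame matrices; the
    symmetric terms then cancel and the coefficients of \<open>cross3\<close> remain.\<close>
  have d: "e 2 p ** e 3 (mat 1) = e 3 p ** e 2 (mat 1) + e 1 p"
     "e 3 p ** e 1 (mat 1) = e 1 p ** e 3 (mat 1) + e 2 p"
     "e 1 p ** e 2 (mat 1) = e 2 p ** e 1 (mat 1) + e 3 p"
    using c[of 2 3] c[of 3 1] c[of 1 2] br12 br23 br31 p by (auto simp: algebra_simps)
  show "lie_bracket X Y p = frame_comb (cross3 a b) p"
    unfolding lie_bracket_represents_commutator[OF assms p]
    by (simp add: frame_comb_def sum_3 matrix_add_ldistrib matrix_add_rdistrib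
        matrix_mul_scaleR_right
        matrix_mul_scaleR_left d cross_components algebra_simps)
qed

end

section \<open>Connection and curvature of the diagonal metric\<close>

locale su2_metric = su2_frame +
  fixes A B C :: real
  assumes pos: "A > 0" "B > 0" "C > 0"
begin

abbreviation g :: tensor2 where "g \<equiv> diag_metric e A B C"

lemma dir_deriv_metric:
  assumes "represents X a" "represents Y b" "p \<in> SU2"
  shows "dir_deriv (\<lambda>q. g q (X q) (Y q)) p (frame_comb c p) = 0"
  using assms
  by (intro dir_deriv_const[where c = "diag_ip A B C a b"] frame_comb_tangent)
    (auto simp: represents_def diag_metric_frame_comb)

text \<open>Only bracket terms survive in the Koszul formula, and \<open>lc_conn\<close> solves it.
  The result again has constant coefficients, so the connection can be iterated in the
  curvature.\<close>

lemma levi_civita_represents: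
  assumes X: "represents X x" and Y: "represents Y y"
  shows "represents (levi_civita g X Y) (lc_conn A B C x y)"
  unfolding represents_def
proof
  fix p assume p: "p \<in> SU2"
  have k: "koszul g X Y (left_ext p (frame_comb z p)) p =
    2 * diag_ip A B C (lc_conn A B C x y) z" for z
  proof -
    note Z = represents_left_ext[OF p, of z]
    have "X p = frame_comb x p" "Y p = frame_comb y p"
      "left_ext p (frame_comb z p) p = frame_comb z p"
      using X Y Z p by (auto simp: represents_def)
    moreover have "lie_bracket X Y p = frame_comb (cross3 x y) p"
      "lie_bracket X (left_ext p (frame_comb z p)) p = frame_comb (cross3 x z) p"
      "lie_bracket Y (left_ext p (frame_comb z p)) p = frame_comb (cross3 y z) p"
      using lie_bracket_represents X Y Z p by (auto simp: represents_def)
    ultimately show ?thesis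
      unfolding koszul_def using dir_deriv_metric X Y Z p
      by (simp add: diag_metric_frame_comb diag_ip_lc_conn[OF pos])
  qed
  show "levi_civita g X Y p = frame_comb (lc_conn A B C x y) p"
    unfolding levi_civita_def
  proof (rule the_equality)
    show "frame_comb (lc_conn A B C x y) p \<in> tangent_space p \<and>
      (\<forall>z\<in>tangent_space p. 2 * g p (frame_comb (lc_conn A B C x y) p) z =
        koszul g X Y (left_ext p z) p)"
      by (auto simp: tangent_space_eq p k diag_metric_frame_comb)
  next
    fix v assume v: "v \<in> tangent_space p \<and>
      (\<forall>z\<in>tangent_space p. 2 * g p v z = koszul g X Y (left_ext p z) p)"
    then obtain a where a: "v = frame_comb a p" by (auto simp: tangent_space_eq p)
    then have "diag_ip A B C a z = diag_ip A B C (lc_conn A B C x y) z" for z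
      using v by (auto simp: tangent_space_eq p k diag_metric_frame_comb)
    then show "v = frame_comb (lc_conn A B C x y) p" using diag_ip_eqD[OF pos] a by blast
  qed
qed

lemma curvature_frame_comb:
  assumes "p \<in> SU2"
  shows "curvature g p (frame_comb x p) (frame_comb y p) (frame_comb z p) =
    frame_comb (lc_curv A B C x y z) p"
proof -
  note r = represents_left_ext[OF assms] and L = levi_civita_represents
  have "represents (levi_civita g (left_ext p (frame_comb x p))
    (levi_civita g (left_ext p (frame_comb y p)) (left_ext p (frame_comb z p))))
    (lc_conn A B C x (lc_conn A B C y z))" for x y z
    by (intro L r)
  moreover have "represents (levi_civita g
    (lie_bracket (left_ext p (frame_comb x p)) (left_ext p (frame_comb y p))) (left_ext p (frame_comb z p)))
    (lc_conn A B C (cross3 x y) z)"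
    by (intro L r lie_bracket_represents)
  ultimately show ?thesis using assms
    by (simp add: curvature_def curvature_field_def lc_curv_def frame_comb_diff represents_def)
qed

text \<open>For independent arguments this is a mean of the three coordinate plane curvatures,
  weighted by the terms of the Gram determinant.\<close>

lemma sectional_frame_comb:
  assumes "p \<in> SU2"
  shows "sectional g p (frame_comb x p) (frame_comb y p) =
    (B * C * plane_curv A B C * (cross3 x y $ 1)\<^sup>2 + C * A * plane_curv B C A * (cross3 x y $ 2)\<^sup>2
     + A * B * plane_curv C A B * (cross3 x y $ 3)\<^sup>2)
    / (B * C * (cross3 x y $ 1)\<^sup>2 + C * A * (cross3 x y $ 2)\<^sup>2 + A * B * (cross3 x y $ 3)\<^sup>2)"
  by (simp add: sectional_def curvature_frame_comb diag_metric_frame_comb assms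
    diag_ip_lc_curv[OF pos] diag_ip_gram)

lemma ricci_frame_comb:
  assumes "p \<in> SU2"
  shows "ricci e g p (frame_comb x p) (frame_comb y p) =
    A * (plane_curv B C A + plane_curv C A B) * (x$1 * y$1)
    + B * (plane_curv A B C + plane_curv C A B) * (x$2 * y$2)
    + C * (plane_curv A B C + plane_curv B C A) * (x$3 * y$3)"
  unfolding ricci_def
  by (simp add: frame_comb_axis[symmetric] curvature_frame_comb coframe_frame_comb assms
    ricci_coord[OF pos])

subsection \<open>Cross curvature and solitons\<close>

text \<open>Entry \<open>i\<close> belongs to the coordinate plane orthogonal to
  \<open>e i\<close>.\<close>

definition kvec :: "real^3" where
  "kvec = vector [plane_curv A B C, plane_curv B C A, plane_curv C A B]"

lemma components_metric:
  "p \<in> SU2 \<Longrightarrow> components e g p = (\<chi> i j. if i = j then vector [A, B, C] $ i else 0)"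
  by (simp add: components_def frame_comb_axis[symmetric] diag_metric_frame_comb
    diag_ip_def vec_eq_iff forall_3 axis_def)

lemma components_ricci:
  "p \<in> SU2 \<Longrightarrow> components e (ricci e g) p =
    (\<chi> i j. if i = j then vector [A * (kvec$2 + kvec$3), B * (kvec$1 + kvec$3),
      C * (kvec$1 + kvec$2)] $ i else 0)"
  by (simp add: components_def frame_comb_axis[symmetric] ricci_frame_comb kvec_def vec_eq_iff
    forall_3 axis_def)

lemma inverse_metric_eq:
  "p \<in> SU2 \<Longrightarrow> inverse_metric e g p = (\<chi> i j. if i = j then vector [1/A, 1/B, 1/C] $ i else 0)"
  using pos by (simp add: inverse_metric_def components_metric matrix_inv_diag)

lemma scalar_curvature_eq:
  "p \<in> SU2 \<Longrightarrow> scalar_curvature e g p = 2 * (kvec$1 + kvec$2 + kvec$3)"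
  using pos by (simp add: scalar_curvature_def inverse_metric_eq components_ricci sum_3)

text \<open>Raising indices turns the first Ricci entry into \<open>(kvec$2 + kvec$3) / A\<close>;
  subtracting \<open>(kvec$1 + kvec$2 + kvec$3) / A\<close>, the scalar curvature term, leaves a
  single curvature with a minus sign.\<close>

lemma P_tensor_eq:
  assumes "p \<in> SU2"
  shows "P_tensor e g p =
    (\<chi> i j. if i = j then vector [- (kvec$1 / A), - (kvec$2 / B), - (kvec$3 / C)] $ i else 0)"
  using pos
  by (simp add: P_tensor_def inverse_metric_eq components_ricci scalar_curvature_eq assms sum_3
      vec_eq_iff forall_3 divide_simps)

text \<open>Normalizing the frame \<open>e\<close> suffices, as it is orthogonal and diagonalizes
  the Ricci tensor. Existence keeps the description in the singular case of
  \<open>cross_curvature\<close> from being vacuous.\<close>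

lemma ricci_frame_exists:
  assumes p: "p \<in> SU2"
  shows "\<exists>f. ricci_frame e g p f"
proof -
  define c :: "3 \<Rightarrow> real" where "c i = 1 / sqrt (vector [A, B, C] $ i)" for i
  have c: "c i \<noteq> 0" for i using pos exhaust_3[of i] by (auto simp: c_def)
  define f where "f i = frame_comb (axis i (c i)) p" for i
  have fe: "f i = c i *\<^sub>R e i p" for i
  proof -
    have "axis i (c i) = c i *\<^sub>R (axis i 1 :: real^3)" by (simp add: axis_def vec_eq_iff)
    then show ?thesis by (simp add: f_def frame_comb_scaleR frame_comb_axis)
  qed
  have inj: "inj f"
    by (rule injI) (use c in \<open>auto simp: f_def frame_comb_eq_iff p axis_eq_axis\<close>)
  have b: "inj (\<lambda>i. e i p)" "independent (range (\<lambda>i. e i p))"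
    "span (range (\<lambda>i. e i p)) = tangent_space p"
    using basis[OF p] by (auto simp: basis_at_def)
  have sub: "range f \<subseteq> tangent_space p" by (auto simp: f_def frame_comb_tangent p)
  have sp: "tangent_space p \<subseteq> span (range f)"
    unfolding b(3)[symmetric]
  proof (intro span_minimal subspace_span image_subsetI)
    fix i
    have "(1 / c i) *\<^sub>R f i \<in> span (range f)" by (intro span_scale span_base) auto
    then show "e i p \<in> span (range f)" using c[of i] by (simp add: fe)
  qed
  \<comment> \<open>Independence by counting: \<open>f\<close> spans a space whose dimension is the
    number of its vectors.\<close>
  have "dim (tangent_space p) = card (range (\<lambda>i. e i p))"
    unfolding b(3)[symmetric] using b(2) by (simp add: dim_eq_card_independent)
  then have "card (range f) \<le> dim (tangent_space p)"
    using inj b(1) by (simp add: card_image)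
  then have "independent (range f)"
    using card_le_dim_spanning[OF sub sp] by simp
  moreover have "span (range f) = tangent_space p"
    using sp sub b(3) by (metis span_minimal subspace_span subset_antisym)
  ultimately have "basis_at p f" using inj by (simp add: basis_at_def)
  moreover have "g p (f i) (f j) = (if i = j then 1 else 0)" for i j
    using pos exhaust_3[of i] exhaust_3[of j]
    by (auto simp: f_def diag_metric_frame_comb p diag_ip_def c_def axis_def)
  moreover have "ricci e g p (f i) (f j) = 0" if "i \<noteq> j" for i j
    using that exhaust_3[of i] exhaust_3[of j] by (auto simp: f_def ricci_frame_comb p axis_def)
  ultimately show ?thesis by (auto simp: ricci_frame_def)
qed

text \<open>All Ricci frames give the same form, even when Ricci eigenvalues coincide. In
  coordinates that make the metric Euclidean this is
  \<open>cofactor_form_orthonormal_frame\<close>.\<close>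

lemma cross_form_eq:
  assumes p: "p \<in> SU2" and f: "ricci_frame e g p f"
  shows "cross_form g p f (frame_comb x p) (frame_comb y p) =
    A * (kvec$2 * kvec$3) * (x$1 * y$1) + B * (kvec$3 * kvec$1) * (x$2 * y$2)
    + C * (kvec$1 * kvec$2) * (x$3 * y$3)"
proof -
  have "f i \<in> range (\<lambda>a. frame_comb a p)" for i
    using f unfolding ricci_frame_def basis_at_def tangent_space_eq[OF p, symmetric]
    by (metis rangeI span_base)
  then have "\<forall>i. \<exists>a. f i = frame_comb a p" by blast
  then obtain F where F: "\<And>i. f i = frame_comb (F i) p" by metis
  \<comment> \<open>\<open>r\<close> is an isometry from \<open>diag_ip A B C\<close> to the
    standard inner product and turns \<open>f\<close> into an orthonormal basis
    \<open>u\<close>.\<close>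
  define r where "r x = (vector [sqrt A * x$1, sqrt B * x$2, sqrt C * x$3] :: real^3)"
    for x :: "real^3"
  have sq: "sqrt A * sqrt A = A" "sqrt B * sqrt B = B" "sqrt C * sqrt C = C"
    using pos by auto
  have sq2: "sqrt A * (a * (sqrt A * b)) = A * (a * b)" "sqrt B * (a * (sqrt B * b)) = B * (a * b)"
    "sqrt C * (a * (sqrt C * b)) = C * (a * b)" for a b
  proof -
    have m: "s * (a * (s * b)) = (s * s) * (a * b)" for s :: real by simp
    show "sqrt A * (a * (sqrt A * b)) = A * (a * b)" "sqrt B * (a * (sqrt B * b)) = B * (a * b)"
      "sqrt C * (a * (sqrt C * b)) = C * (a * b)"
      unfolding m sq by (rule refl)+
  qed
  have sq3: "sqrt A * (sqrt A * a) = A * a" "sqrt B * (sqrt B * a) = B * a"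
    "sqrt C * (sqrt C * a) = C * a" for a
    using sq by (simp_all flip: mult.assoc)
  have diag_ip: "r x \<bullet> r y = diag_ip A B C x y" for x y
    by (simp add: r_def diag_ip_def inner_vec_def sum_3 mult.assoc sq2)
  define u where "u i = r (F i)" for i
  have on: "u i \<bullet> u j = (if i = j then 1 else 0)" for i j
    using f by (simp add: u_def diag_ip ricci_frame_def F diag_metric_frame_comb p)
  obtain t where t: "t\<^sup>2 = 1" and c: "cross3 (u 2) (u 3) = t *\<^sub>R u 1"
    "cross3 (u 3) (u 1) = t *\<^sub>R u 2" "cross3 (u 1) (u 2) = t *\<^sub>R u 3"
    using orthonormal_cross[OF on] by metis
  define K where "K i = (\<Sum>n\<in>UNIV. kvec$n * (u i $ n)\<^sup>2)" for i
  have off: "(\<Sum>n\<in>UNIV. kvec$n * (u i $ n * u j $ n)) = 0" if "i \<noteq> j" for i j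
  proof -
    \<comment> \<open>The Ricci form is a multiple of the inner product minus the form with diagonal
      \<open>kvec\<close>, so an orthonormal basis that diagonalizes one diagonalizes the
      other.\<close>
    have "(kvec$1 + kvec$2 + kvec$3) * (u i \<bullet> u j) - (\<Sum>n\<in>UNIV. kvec$n * (u i $ n * u j $ n)) =
      ricci e g p (f i) (f j)"
      unfolding F ricci_frame_comb[OF p]
      by (simp add: u_def r_def kvec_def inner_vec_def sum_3 sq3 algebra_simps)
    then show ?thesis using f that on by (simp add: ricci_frame_def)
  qed
  have sec: "sectional g p (f i) (f j) = K l"
    if "i \<noteq> j" "cross3 (u i) (u j) = t *\<^sub>R u l" for i j l
  proof -
    have "diag_ip A B C (F i) (F i) * diag_ip A B C (F j) (F j) - (diag_ip A B C (F i) (F j))\<^sup>2 = 1"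
      using on that(1) by (simp add: u_def diag_ip)
    \<comment> \<open>The scaling \<open>r\<close> absorbs the weights, so the curvature of a plane
      is the \<open>kvec\<close> form on its unit normal; the sign \<open>t\<close> disappears on
      squaring.\<close>
    moreover have "diag_ip A B C (lc_curv A B C (F i) (F j) (F j)) (F i) =
      (\<Sum>n\<in>UNIV. kvec$n * (cross3 (u i) (u j) $ n)\<^sup>2)"
      unfolding diag_ip_lc_curv[OF pos]
      by (simp add: u_def r_def kvec_def sum_3 cross_components power2_eq_square sq3 algebra_simps)
    moreover have "(\<Sum>n\<in>UNIV. kvec$n * (cross3 (u i) (u j) $ n)\<^sup>2) = K l"
      unfolding that(2) K_def using t by (simp add: power_mult_distrib)
    ultimately show ?thesis
      by (simp add: sectional_def F curvature_frame_comb diag_metric_frame_comb p)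
  qed
  have "cross_form g p f (frame_comb x p) (frame_comb y p) =
      K 2 * K 3 * ((r x \<bullet> u 1) * (r y \<bullet> u 1)) + K 3 * K 1 * ((r x \<bullet> u 2) * (r y \<bullet> u 2))
    + K 1 * K 2 * ((r x \<bullet> u 3) * (r y \<bullet> u 3))"
    unfolding cross_form_def Let_def sec[OF _ c(1), simplified] sec[OF _ c(2), simplified]
      sec[OF _ c(3), simplified]
    by (simp add: diag_ip u_def F diag_metric_frame_comb p)
  also have "\<dots> = kvec$2 * kvec$3 * (r x$1 * r y$1) + kvec$3 * kvec$1 * (r x$2 * r y$2)
    + kvec$1 * kvec$2 * (r x$3 * r y$3)"
    by (rule cofactor_form_orthonormal_frame[OF on off K_def])
  finally show ?thesis by (simp add: r_def sq3 mult_ac)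
qed

text \<open>Both branches agree: for invertible \<open>P_tensor\<close> the determinant quotient is
  minus the product of the curvatures, and dividing it by \<open>- (kvec$1 / A)\<close> leaves
  \<open>A * (kvec$2 * kvec$3)\<close>.\<close>

lemma cross_curvature_frame_comb:
  assumes p: "p \<in> SU2"
  shows "cross_curvature e g p (frame_comb x p) (frame_comb y p) =
    A * (kvec$2 * kvec$3) * (x$1 * y$1) + B * (kvec$3 * kvec$1) * (x$2 * y$2)
    + C * (kvec$1 * kvec$2) * (x$3 * y$3)"
proof (cases "invertible (P_tensor e g p)")
  case True
  then have nz: "kvec$1 \<noteq> 0" "kvec$2 \<noteq> 0" "kvec$3 \<noteq> 0"
    unfolding invertible_det_nz P_tensor_eq[OF p] det_diag by auto
  then have "matrix_inv (P_tensor e g p) =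
    (\<chi> i j. if i = j then vector [1 / - (kvec$1 / A), 1 / - (kvec$2 / B), 1 / - (kvec$3 / C)] $ i
      else 0)"
    unfolding P_tensor_eq[OF p] using pos by (intro matrix_inv_diag) auto
  moreover have "det (P_tensor e g p) / det (inverse_metric e g p) = - (kvec$1 * kvec$2 * kvec$3)"
    using pos unfolding P_tensor_eq[OF p] inverse_metric_eq[OF p] det_diag
    by (simp add: field_simps)
  ultimately show ?thesis using True nz pos
    by (simp add: cross_curvature_def coframe_frame_comb p sum_3 field_simps)
next
  case False
  have "(THE h. \<forall>f. ricci_frame e g p f \<longrightarrow> h = cross_form g p f (frame_comb x p) (frame_comb y p)) =
    A * (kvec$2 * kvec$3) * (x$1 * y$1) + B * (kvec$3 * kvec$1) * (x$2 * y$2)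
    + C * (kvec$1 * kvec$2) * (x$3 * y$3)"
    using cross_form_eq[OF p] ricci_frame_exists[OF p] by (intro the_equality) auto
  then show ?thesis using False by (simp add: cross_curvature_def)
qed

section \<open>The soliton equation\<close>

lemma su2_eq: "su2 = range (\<lambda>a. frame_comb a (mat 1))"
  by (simp add: su2_def tangent_space_eq mat_1_in_SU2)

lemma su2_bracket_frame_comb:
  "su2_bracket (frame_comb a (mat 1)) (frame_comb b (mat 1)) = frame_comb (cross3 a b) (mat 1)"
  using lie_bracket_represents[OF represents_left_ext represents_left_ext] mat_1_in_SU2
  by (simp add: su2_bracket_def represents_def)

text \<open>Comparison with the metric cancels \<open>A\<close>, \<open>B\<close>, \<open>C\<close>
  from the cross curvature.\<close>

lemma hat_xcf:
  "hat g (\<lambda>p x y. \<sigma> * cross_curvature e g p x y) (frame_comb x (mat 1)) =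
    frame_comb (vector [\<sigma> * (kvec$2 * kvec$3) * x$1, \<sigma> * (kvec$3 * kvec$1) * x$2,
      \<sigma> * (kvec$1 * kvec$2) * x$3]) (mat 1)"
  (is "_ = frame_comb ?v _")
proof -
  note I = mat_1_in_SU2
  have v: "\<sigma> * cross_curvature e g (mat 1) (frame_comb x (mat 1)) (frame_comb y (mat 1)) =
    diag_ip A B C ?v y" for y
    by (simp add: cross_curvature_frame_comb I diag_ip_def algebra_simps)
  show ?thesis unfolding hat_def
  proof (rule the_equality)
    show "frame_comb ?v (mat 1) \<in> su2 \<and> (\<forall>y\<in>su2. g (mat 1) (frame_comb ?v (mat 1)) y =
        \<sigma> * cross_curvature e g (mat 1) (frame_comb x (mat 1)) y)"
      by (auto simp: su2_eq v diag_metric_frame_comb I)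
  next
    fix w assume w: "w \<in> su2 \<and> (\<forall>y\<in>su2. g (mat 1) w y =
        \<sigma> * cross_curvature e g (mat 1) (frame_comb x (mat 1)) y)"
    then obtain a where a: "w = frame_comb a (mat 1)" by (auto simp: su2_eq)
    then have "diag_ip A B C a z = diag_ip A B C ?v z" for z
      using w by (auto simp: su2_eq v diag_metric_frame_comb I)
    then show "w = frame_comb ?v (mat 1)" using diag_ip_eqD[OF pos] a by blast
  qed
qed

lemma xcf_soliton_imp:
  assumes "xcf_algebraic_soliton e \<sigma> g" "\<sigma> \<noteq> 0"
  shows "kvec$2 * kvec$3 = kvec$3 * kvec$1 \<and> kvec$3 * kvec$1 = kvec$1 * kvec$2"
proof -
  obtain \<kappa> where D: "su2_derivation (\<lambda>x. hat g (\<lambda>p x y. \<sigma> * cross_curvature e g p x y) x - \<kappa> *\<^sub>R x)"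
    using assms by (auto simp: xcf_algebraic_soliton_def algebraic_soliton_def)
  define d where "d = (vector [\<sigma> * (kvec$2 * kvec$3) - \<kappa>, \<sigma> * (kvec$3 * kvec$1) - \<kappa>,
    \<sigma> * (kvec$1 * kvec$2) - \<kappa>] :: real^3)"
  have hd: "hat g (\<lambda>p x y. \<sigma> * cross_curvature e g p x y) (frame_comb x (mat 1))
      - \<kappa> *\<^sub>R frame_comb x (mat 1)
     = frame_comb (\<chi> i. d$i * x$i) (mat 1)" for x
    unfolding hat_xcf frame_comb_scaleR[symmetric] frame_comb_diff[symmetric]
      frame_comb_eq_iff[OF mat_1_in_SU2]
    by (simp add: d_def vec_eq_iff forall_3 algebra_simps)
  have der: "(\<chi> i. d$i * cross3 x y$i) = cross3 (\<chi> i. d$i * x$i) y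
    + cross3 x (\<chi> i. d$i * y$i)" for x y
    using D unfolding su2_derivation_def su2_eq
    by (simp add: hd su2_bracket_frame_comb frame_comb_add[symmetric]
      frame_comb_eq_iff[OF mat_1_in_SU2])
  \<comment> \<open>The derivation rule is tested on the three brackets of basis vectors, each in
    its only nonzero component.\<close>
  have "d$1 = d$2 + d$3" "d$2 = d$3 + d$1" "d$3 = d$1 + d$2"
    using arg_cong[OF der[of "axis 2 1" "axis 3 1"], of "\<lambda>v. v$1"]
      arg_cong[OF der[of "axis 3 1" "axis 1 1"], of "\<lambda>v. v$2"]
      arg_cong[OF der[of "axis 1 1" "axis 2 1"], of "\<lambda>v. v$3"]
    by (simp_all add: cross_components axis_def)
  then have "d$1 = 0" "d$2 = 0" "d$3 = 0" by linarith+
  then have "\<sigma> * (kvec$2 * kvec$3) = \<sigma> * (kvec$3 * kvec$1)"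
    "\<sigma> * (kvec$3 * kvec$1) = \<sigma> * (kvec$1 * kvec$2)"
    by (simp_all add: d_def)
  then show ?thesis using assms(2) by (metis mult_cancel_left)
qed

text \<open>The operator is \<open>h\<close> times the identity, so \<kappa> is taken to be
  \<open>h\<close> and the difference is the zero derivation.\<close>

lemma xcf_soliton_round:
  assumes "A = B" "B = C"
  shows "xcf_algebraic_soliton e \<sigma> g"
proof -
  define h where "h = \<sigma> * (kvec$1 * kvec$2)"
  have "kvec$1 = kvec$2" "kvec$2 = kvec$3" unfolding kvec_def using assms by simp_all
  then have "hat g (\<lambda>p x y. \<sigma> * cross_curvature e g p x y) (frame_comb x (mat 1)) =
    h *\<^sub>R frame_comb x (mat 1)" for x
    unfolding hat_xcf frame_comb_scaleR[symmetric] frame_comb_eq_iff[OF mat_1_in_SU2]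
    by (simp add: h_def vec_eq_iff forall_3)
  moreover define T where
    "T = (\<lambda>x. hat g (\<lambda>p x y. \<sigma> * cross_curvature e g p x y) x - h *\<^sub>R x)"
  ultimately have T: "T (frame_comb x (mat 1)) = frame_comb 0 (mat 1)" for x
    by (simp add: frame_comb_zero)
  have "su2_derivation T"
    unfolding su2_derivation_def su2_eq
    by (auto simp: T su2_bracket_frame_comb frame_comb_add[symmetric] frame_comb_scaleR[symmetric])
  then show ?thesis unfolding xcf_algebraic_soliton_def algebraic_soliton_def T_def by blast
qed

section \<open>Constant sectional curvature\<close>

lemma constant_curvature_imp:
  assumes "constant_sectional_curvature g"
  shows "kvec$1 = kvec$2 \<and> kvec$2 = kvec$3"
proof -
  note I = mat_1_in_SU2
  obtain k where k: "\<And>x y. x \<in> tangent_space (mat 1) \<Longrightarrow> y \<in> tangent_space (mat 1) \<Longrightarrow> x \<noteq> y \<Longrightarrow>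
      independent {x, y} \<Longrightarrow> sectional g (mat 1) x y = k"
    using assms I unfolding constant_sectional_curvature_def by blast
  have ij: "sectional g (mat 1) (frame_comb (axis i 1) (mat 1)) (frame_comb (axis j 1) (mat 1)) = k"
    if "i \<noteq> j" for i j
  proof (rule k)
    show "frame_comb (axis i 1) (mat 1) \<noteq> frame_comb (axis j 1) (mat 1)"
      using that by (simp add: frame_comb_eq_iff I axis_eq_axis)
    show "independent {frame_comb (axis i 1) (mat 1), frame_comb (axis j 1) (mat 1)}"
      using basis[OF I] unfolding basis_at_def frame_comb_axis
      by (elim conjE) (rule independent_mono, assumption, blast)
  qed (simp_all add: frame_comb_tangent I)
  \<comment> \<open>On a coordinate plane the cross product has one nonzero component, so the
    weighted mean reduces to one entry of \<open>kvec\<close>.\<close>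
  show ?thesis
    using ij[of 2 3] ij[of 3 1] ij[of 1 2] pos
    by (simp add: sectional_frame_comb I cross_components axis_def kvec_def)
qed

text \<open>The three averaged curvatures coincide, so the mean is constant once its denominator is
  nonzero. A vanishing cross product would make the coordinate vectors collinear, hence the tangent
  vectors dependent.\<close>

lemma constant_curvature_round:
  assumes "A = B" "B = C"
  shows "constant_sectional_curvature g"
  unfolding constant_sectional_curvature_def
proof (intro exI[of _ "plane_curv A A A"] ballI impI)
  fix p v w assume p: "p \<in> SU2" and "v \<in> tangent_space p" "w \<in> tangent_space p"
    and ind: "v \<noteq> w \<and> independent {v, w}"
  then obtain x y where xy: "v = frame_comb x p" "w = frame_comb y p"
    by (auto simp: tangent_space_eq)
  have "cross3 x y \<noteq> 0"
  proof
    assume "cross3 x y = 0"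
    then have "collinear {0, x, y}" by (simp add: cross_eq_0)
    then consider "x = 0" | "y = 0" | c where "y = c *\<^sub>R x"
      by (auto simp: collinear_lemma)
    then show False
    proof cases
      case 3
      then have "w \<in> span {v}" unfolding xy by (simp add: frame_comb_scaleR span_scale span_base)
      then have "dependent {v, w}"
        using ind unfolding dependent_def by (auto intro!: bexI[of _ w] simp: insert_Diff_if)
      then show False using ind by simp
    qed (use ind in \<open>auto simp: xy frame_comb_zero dependent_zero\<close>)
  qed
  then have "(cross3 x y $ 1)\<^sup>2 + (cross3 x y $ 2)\<^sup>2 + (cross3 x y $ 3)\<^sup>2 \<noteq> 0"
    by (auto simp: vec_eq_iff forall_3 add_nonneg_eq_0_iff)
  then have nz: "B * C * (cross3 x y $ 1)\<^sup>2 + C * A * (cross3 x y $ 2)\<^sup>2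
    + A * B * (cross3 x y $ 3)\<^sup>2 \<noteq> 0"
    using assms pos by (simp flip: distrib_left)
  then show "sectional g p v w = plane_curv A A A"
    unfolding xy sectional_frame_comb[OF p] divide_eq_eq_numeral using assms
    by (simp add: divide_simps) (simp add: algebra_simps)
qed

end

theorem proposition3p12:
  fixes e :: "3 \<Rightarrow> vfield" and A B C \<sigma> :: real
  assumes "left_invariant_frame e"
    and "\<forall>p\<in>SU2. lie_bracket (e 2) (e 3) p = e 1 p"
    and "\<forall>p\<in>SU2. lie_bracket (e 3) (e 1) p = e 2 p"
    and "\<forall>p\<in>SU2. lie_bracket (e 1) (e 2) p = e 3 p"
    and "A > 0" and "B > 0" and "C > 0"
    and "\<sigma> \<in> {1, -1}"
  shows "(xcf_algebraic_soliton e \<sigma> (diag_metric e A B C) \<longleftrightarrow>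
            constant_sectional_curvature (diag_metric e A B C)) \<and>
         (constant_sectional_curvature (diag_metric e A B C) \<longleftrightarrow> A = B \<and> B = C)"
proof -
  interpret su2_metric e A B C
    using assms by unfold_locales auto
  have "\<sigma> \<noteq> 0" using assms by auto
  have "A = B \<and> B = C" if "kvec$2 * kvec$3 = kvec$3 * kvec$1" "kvec$3 * kvec$1 = kvec$1 * kvec$2"
    using plane_curv_products_eqD[OF pos] that unfolding kvec_def vector_3 .
  \<comment> \<open>Constant curvature makes the entries of \<open>kvec\<close> equal, hence also
    their products, so one criterion serves both hypotheses.\<close>
  then have "A = B \<and> B = C" if "xcf_algebraic_soliton e \<sigma> g \<or> constant_sectional_curvature g"
    using that xcf_soliton_imp[OF _ \<open>\<sigma> \<noteq> 0\<close>] constant_curvature_imp by auto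
  then show ?thesis
    using xcf_soliton_round constant_curvature_round by blast
qed

end
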